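(* For any two incomparable patterns $\sigma\in\mathcal S_k$ and $\tau\in\mathcal S_\ell$, $$\Pr(\sigma\prec\tau)=\frac{\mathbb E F_{\tau\to\sigma}+\mathbb E T_\tau-\mathbb E T_\sigma}{\mathbb E F_{\tau\to\sigma}+\mathbb E F_{\sigma\to\tau}}.$$
   Context: $\mathcal S_k$ is the set of permutations of $\{1,\dots,k\}$. For a sequence of distinct reals, $\mathrm{st}$ replaces the smallest entry by $1$, the second smallest by $2$, etc. A consecutive occurrence of $\sigma\in\mathcal S_k$ in a sequence is a block of $k$ adjacent entries whose standardization is $\sigma$. Two patterns are incomparable if neither contains a consecutive occurrence of the other. Let $X_1,X_2,\dots$ be i.i.d. continuous random variables (e.g. uniform on $[0,1]$). $T_\sigma$ is the smallest $j$ such that $X_1,\dots,X_j$ contains a consecutive occurrence of $\sigma$. $\Pr(\sigma\prec\tau)$ is the probability that $\sigma$ appears before $\tau$ in the random sequence, i.e. $\Pr(T_\sigma<T_\tau)$. $F_{\sigma\to\tau}$ is the number of further draws needed to see $\tau$ after the first occurrence of $\sigma$, assuming that $\sigma$ occurs before $\tau$; that is, $F_{\sigma\to\tau}$ has the distribution of $T_\tau-T_\sigma$ conditioned on $T_\sigma<T_\tau$. *)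

theory Defs
  imports
    "HOL-Probability.Probability"
    "HOL-Library.Sublist"
    "HOL-Combinatorics.Multiset_Permutations"
begin

text \<open>
  A permutation of \<open>{1..k}\<close> is given in one-line notation, as a list in
  \<open>permutations_of_set {1..k}\<close>.
\<close>

text \<open>
  On a list with repeated entries \<open>st\<close> also returns a list with repeated entries, so such a list
  is never an occurrence of a permutation.
\<close>

definition st :: "'a::linorder list \<Rightarrow> nat list" where
  "st xs = map (\<lambda>x. card {y \<in> set xs. y \<le> x}) xs"

definition contains_pattern :: "'a::linorder list \<Rightarrow> nat list \<Rightarrow> bool" where
  "contains_pattern xs \<sigma> \<longleftrightarrow> (\<exists>ys. sublist ys xs \<and> st ys = \<sigma>)"

definition incomparable :: "nat list \<Rightarrow> nat list \<Rightarrow> bool" where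
  "incomparable \<sigma> \<tau> \<longleftrightarrow> \<not> contains_pattern \<sigma> \<tau> \<and> \<not> contains_pattern \<tau> \<sigma>"

text \<open>
  The draws are indexed from \<open>0\<close>, so the first \<open>j\<close> draws are \<open>X 0, \<dots>, X (j - 1)\<close>.
  The value is \<open>\<infinity>\<close> if the pattern never occurs.
\<close>

definition T :: "(nat \<Rightarrow> 'w \<Rightarrow> real) \<Rightarrow> nat list \<Rightarrow> 'w \<Rightarrow> enat" where
  "T X \<sigma> \<omega> = Inf {enat j |j. contains_pattern (map (\<lambda>i. X i \<omega>) [0..<j]) \<sigma>}"

text \<open>The law of \<open>F\<^bsub>\<sigma>\<rightarrow>\<tau>\<^esub>\<close>; \<open>uniform_measure M A\<close> is \<open>M\<close> conditioned on \<open>A\<close>.\<close>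

definition F_law :: "'w measure \<Rightarrow> (nat \<Rightarrow> 'w \<Rightarrow> real) \<Rightarrow> nat list \<Rightarrow> nat list \<Rightarrow> enat measure" where
  "F_law M X \<sigma> \<tau> =
     distr (uniform_measure M {\<omega> \<in> space M. T X \<sigma> \<omega> < T X \<tau> \<omega>}) (count_space UNIV)
       (\<lambda>\<omega>. T X \<tau> \<omega> - T X \<sigma> \<omega>)"

text \<open>
  Expectations are taken in \<open>[0, \<infinity>]\<close> and embedded in \<open>ereal\<close>, where differences are not truncated.
\<close>

definition mean :: "'w measure \<Rightarrow> ('w \<Rightarrow> enat) \<Rightarrow> ereal" where
  "mean N f = enn2ereal (\<integral>\<^sup>+\<omega>. ennreal_of_enat (f \<omega>) \<partial>N)"

definition mean_T :: "'w measure \<Rightarrow> (nat \<Rightarrow> 'w \<Rightarrow> real) \<Rightarrow> nat list \<Rightarrow> ereal" where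
  "mean_T M X \<sigma> = mean M (T X \<sigma>)"

definition mean_F :: "'w measure \<Rightarrow> (nat \<Rightarrow> 'w \<Rightarrow> real) \<Rightarrow> nat list \<Rightarrow> nat list \<Rightarrow> ereal" where
  "mean_F M X \<sigma> \<tau> = mean (F_law M X \<sigma> \<tau>) (\<lambda>n. n)"

end

theory Submission
  imports Defs
begin

text \<open>
  Let \<open>p\<close> and \<open>q\<close> be the probabilities that \<open>\<sigma>\<close> and \<open>\<tau>\<close>, respectively, appear first. The later of the
  two times is \<open>T\<^sub>\<sigma>\<close> plus the positive part of \<open>T\<^sub>\<tau> - T\<^sub>\<sigma>\<close>, and symmetrically with \<open>\<sigma>\<close> and \<open>\<tau>\<close>
  exchanged. The positive part of \<open>T\<^sub>\<tau> - T\<^sub>\<sigma>\<close> has expectation \<open>p * E F\<^bsub>\<sigma>\<rightarrow>\<tau>\<^esub>\<close>, so taking expectations gives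
  \<open>E T\<^sub>\<sigma> + p * E F\<^bsub>\<sigma>\<rightarrow>\<tau>\<^esub> = E T\<^sub>\<tau> + q * E F\<^bsub>\<tau>\<rightarrow>\<sigma>\<^esub>\<close>.
  Substituting \<open>q = 1 - p\<close> and solving for \<open>p\<close> is the claim.

  Two facts have to be supplied. First, \<open>p + q = 1\<close>: the two times are never equal and finite, since two
  windows with the same end are nested and this would make one pattern contain the other
  (\<open>T_neq_if_incomparable\<close>). Second, all expectations are finite, so that one may subtract and
  divide: the sequence is cut into independent blocks of length \<open>k\<close>, each of which is an occurrence of
  \<open>\<sigma>\<close> with at least a fixed positive probability, so \<open>T\<^sub>\<sigma>\<close> has a geometric tail
  (\<open>T_tail_le\<close>, \<open>nn_integral_T_finite\<close>). The denominator is nonzero, because at least one of \<open>p\<close>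
  and \<open>q\<close> is positive and the corresponding waiting time is at least 1.
\<close>

section \<open>Standardization and order isomorphism\<close>

lemma card_image_eq_if_same_kernel:
  assumes "\<And>a b. a \<in> J \<Longrightarrow> b \<in> J \<Longrightarrow> f a = f b \<longleftrightarrow> g a = g b"
  shows "card (f ` J) = card (g ` J)"
proof (rule bij_betw_same_card[of "\<lambda>y. g (inv_into J f y)"])
  have eq: "g (inv_into J f (f a)) = g a" if "a \<in> J" for a
    using assms[of "inv_into J f (f a)" a] that
    by (simp add: inv_into_into f_inv_into_f)
  show "bij_betw (\<lambda>y. g (inv_into J f y)) (f ` J) (g ` J)"
  proof (rule bij_betw_imageI)
    show "inj_on (\<lambda>y. g (inv_into J f y)) (f ` J)"
    proof (rule inj_onI, clarify)
      fix a b assume "a \<in> J" "b \<in> J" "g (inv_into J f (f a)) = g (inv_into J f (f b))"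
      then show "f a = f b" using eq assms[of a b] by simp
    qed
    show "(\<lambda>y. g (inv_into J f y)) ` f ` J = g ` J"
      using eq by (simp add: image_image)
  qed
qed

lemma length_st [simp]: "length (st xs) = length xs"
  by (simp add: st_def)

lemma st_nth: "i < length xs \<Longrightarrow> st xs ! i = card {y \<in> set xs. y \<le> xs ! i}"
  by (simp add: st_def)

lemma st_nth_le_iff:
  assumes "i < length xs" "j < length xs"
  shows "st xs ! i \<le> st xs ! j \<longleftrightarrow> xs ! i \<le> xs ! j"
proof (cases "xs ! i \<le> xs ! j")
  case True
  then have "st xs ! i \<le> st xs ! j"
    unfolding st_nth[OF assms(1)] st_nth[OF assms(2)]
    by (intro card_mono) auto
  with True show ?thesis by simp
next
  case False
  then have "{y \<in> set xs. y \<le> xs ! j} \<subseteq> {y \<in> set xs. y \<le> xs ! i}"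
    by auto
  moreover have "xs ! i \<in> {y \<in> set xs. y \<le> xs ! i}" "xs ! i \<notin> {y \<in> set xs. y \<le> xs ! j}"
    using False assms(1) by simp_all
  ultimately have "{y \<in> set xs. y \<le> xs ! j} \<subset> {y \<in> set xs. y \<le> xs ! i}"
    by blast
  then have "st xs ! j < st xs ! i"
    unfolding st_nth[OF assms(1)] st_nth[OF assms(2)]
    by (intro psubset_card_mono) simp_all
  with False show ?thesis by simp
qed

text \<open>
  The rank of an entry counts distinct values, not positions. The two sets of values below the
  \<open>i\<close>-th entries are images of one and the same set of positions, and equality of entries is
  also determined by \<open>\<le>\<close>, so these images have the same size.
\<close>

lemma st_cong:
  assumes len: "length xs = length ys"
    and le: "\<And>i j. i < length xs \<Longrightarrow> j < length xs \<Longrightarrow> xs ! i \<le> xs ! j \<longleftrightarrow> ys ! i \<le> ys ! j"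
  shows "st xs = st ys"
proof (rule nth_equalityI)
  fix i assume "i < length (st xs)"
  then have i: "i < length xs" by simp
  let ?J = "{j. j < length xs \<and> xs ! j \<le> xs ! i}"
  have "{y \<in> set xs. y \<le> xs ! i} = (!) xs ` ?J"
    by (auto simp: in_set_conv_nth)
  moreover have "{y \<in> set ys. y \<le> ys ! i} = (!) ys ` ?J"
    using len le i by (auto simp: in_set_conv_nth)
  moreover have "card ((!) xs ` ?J) = card ((!) ys ` ?J)"
    by (rule card_image_eq_if_same_kernel) (auto simp: order.eq_iff le)
  ultimately show "st xs ! i = st ys ! i"
    using i len by (simp add: st_nth)
qed (simp add: len)

lemma st_permutation:
  assumes "\<sigma> \<in> permutations_of_set {1..k}"
  shows "st \<sigma> = \<sigma>"
proof (rule nth_equalityI)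
  fix i assume "i < length (st \<sigma>)"
  then have i: "i < length \<sigma>" by simp
  have set: "set \<sigma> = {1..k}"
    using assms by (simp add: permutations_of_set_def)
  then have "\<sigma> ! i \<in> {1..k}"
    using nth_mem[OF i] by simp
  then have "{y \<in> set \<sigma>. y \<le> \<sigma> ! i} = {1..\<sigma> ! i}"
    unfolding set by auto
  then show "st \<sigma> ! i = \<sigma> ! i"
    by (simp add: st_nth[OF i])
qed simp

text \<open>
  A permutation is its own standardization, so having it as standardization means being order
  isomorphic to it. Occurrence of a pattern thereby becomes a finite conjunction of comparisons between draws. This
  form serves both to prove measurability and to produce occurrences.
\<close>

lemma st_eq_permutation_iff:
  assumes "\<sigma> \<in> permutations_of_set {1..k}"
  shows "st xs = \<sigma> \<longleftrightarrow> length xs = length \<sigma> \<and>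
    (\<forall>i<length \<sigma>. \<forall>j<length \<sigma>. xs ! i \<le> xs ! j \<longleftrightarrow> \<sigma> ! i \<le> \<sigma> ! j)"
proof
  assume "st xs = \<sigma>"
  then show "length xs = length \<sigma> \<and>
    (\<forall>i<length \<sigma>. \<forall>j<length \<sigma>. xs ! i \<le> xs ! j \<longleftrightarrow> \<sigma> ! i \<le> \<sigma> ! j)"
    by (metis length_st st_nth_le_iff)
next
  assume "length xs = length \<sigma> \<and>
    (\<forall>i<length \<sigma>. \<forall>j<length \<sigma>. xs ! i \<le> xs ! j \<longleftrightarrow> \<sigma> ! i \<le> \<sigma> ! j)"
  then have "st xs = st \<sigma>" by (intro st_cong) simp_all
  then show "st xs = \<sigma>" by (simp add: st_permutation[OF assms])
qed

lemma st_drop_st: "st (drop n (st xs)) = st (drop n xs)"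
  by (rule st_cong) (simp_all add: st_nth_le_iff less_diff_conv add.commute)

section \<open>First occurrence times\<close>

lemma contains_pattern_iff_window:
  "contains_pattern (map f [0..<j]) \<sigma> \<longleftrightarrow>
     (\<exists>a. a + length \<sigma> \<le> j \<and> st (map f [a..<a + length \<sigma>]) = \<sigma>)"
proof
  assume "contains_pattern (map f [0..<j]) \<sigma>"
  then obtain ps ys ss where eq: "map f [0..<j] = ps @ ys @ ss" and st: "st ys = \<sigma>"
    unfolding contains_pattern_def sublist_def by auto
  have len: "length ys = length \<sigma>" using st by auto
  have j: "length ps + length ys + length ss = j"
    using arg_cong[OF eq, of length] by simp
  have "ys = take (length ys) (drop (length ps) (map f [0..<j]))"
    unfolding eq by simp
  also have "\<dots> = map f [length ps..<length ps + length ys]"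
    using j by (simp add: drop_map take_map)
  finally have "ys = map f [length ps..<length ps + length \<sigma>]"
    by (simp only: len)
  then show "\<exists>a. a + length \<sigma> \<le> j \<and> st (map f [a..<a + length \<sigma>]) = \<sigma>"
    using st j len by (intro exI[of _ "length ps"]) auto
next
  assume "\<exists>a. a + length \<sigma> \<le> j \<and> st (map f [a..<a + length \<sigma>]) = \<sigma>"
  then obtain a where a: "a + length \<sigma> \<le> j" "st (map f [a..<a + length \<sigma>]) = \<sigma>" by auto
  have "[0..<j] = [0..<a] @ [a..<a + length \<sigma>] @ [a + length \<sigma>..<j]"
    using a(1) upt_add_eq_append[of 0 a "j - a"]
      upt_add_eq_append[of a "a + length \<sigma>" "j - (a + length \<sigma>)"] by simp
  then have "sublist (map f [a..<a + length \<sigma>]) (map f [0..<j])"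
    unfolding sublist_def by (metis map_append)
  then show "contains_pattern (map f [0..<j]) \<sigma>"
    unfolding contains_pattern_def using a(2) by blast
qed

lemma T_le_iff:
  "T X \<sigma> \<omega> \<le> enat j \<longleftrightarrow>
     (\<exists>a. a + length \<sigma> \<le> j \<and> st (map (\<lambda>i. X i \<omega>) [a..<a + length \<sigma>]) = \<sigma>)"
  (is "_ \<longleftrightarrow> ?R j")
proof
  let ?S = "{enat j |j. contains_pattern (map (\<lambda>i. X i \<omega>) [0..<j]) \<sigma>}"
  assume le: "T X \<sigma> \<omega> \<le> enat j"
  then have ne: "?S \<noteq> {}"
    unfolding T_def Inf_enat_def by (auto split: if_splits)
  then have "Inf ?S \<in> ?S"
    unfolding Inf_enat_def by (auto intro: LeastI)
  then obtain i where "T X \<sigma> \<omega> = enat i" "?R i"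
    unfolding T_def contains_pattern_iff_window by blast
  with le show "?R j"
    using order_trans by fastforce
next
  assume R: "?R j"
  show "T X \<sigma> \<omega> \<le> enat j"
    unfolding T_def contains_pattern_iff_window
    by (intro Inf_lower CollectI exI[of _ j] conjI refl R)
qed

text \<open>An occurrence whose window ended before \<open>j\<close> would make the first occurrence time smaller.\<close>

lemma T_eq_enatD:
  assumes "T X \<sigma> \<omega> = enat j"
  obtains a where "a + length \<sigma> = j" "st (map (\<lambda>i. X i \<omega>) [a..<a + length \<sigma>]) = \<sigma>"
proof -
  obtain a where a: "a + length \<sigma> \<le> j" "st (map (\<lambda>i. X i \<omega>) [a..<a + length \<sigma>]) = \<sigma>"
    using assms T_le_iff[of X \<sigma> \<omega> j] by auto
  then have "T X \<sigma> \<omega> \<le> enat (a + length \<sigma>)"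
    by (auto simp: T_le_iff)
  with a assms that show thesis by simp
qed

text \<open>
  If two patterns occur in windows with the same end, the shorter window is a suffix of the longer
  one. Standardizing a suffix of a standardized sequence is the same as standardizing the suffix
  itself, so the corresponding suffix of the longer pattern is an occurrence of the shorter pattern.
\<close>

lemma contains_pattern_if_common_end:
  assumes "length \<sigma> \<le> length \<tau>" and "a + length \<sigma> = b + length \<tau>"
    and "st (map f [a..<a + length \<sigma>]) = \<sigma>"
    and "st (map f [b..<b + length \<tau>]) = \<tau>"
  shows "contains_pattern \<tau> \<sigma>"
proof -
  have "drop (length \<tau> - length \<sigma>) (map f [b..<b + length \<tau>]) = map f [a..<a + length \<sigma>]"
  proof -
    have "a = b + length \<tau> - length \<sigma>" using assms(2) by simp
    with assms(1) show ?thesis by (simp add: drop_map)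
  qed
  then have "st (drop (length \<tau> - length \<sigma>) \<tau>) = \<sigma>"
    using st_drop_st[of "length \<tau> - length \<sigma>" "map f [b..<b + length \<tau>]"] assms(3,4) by simp
  then show ?thesis
    unfolding contains_pattern_def by (metis sublist_drop)
qed

lemma T_neq_if_incomparable:
  assumes "incomparable \<sigma> \<tau>" and "T X \<sigma> \<omega> = enat j"
  shows "T X \<tau> \<omega> \<noteq> enat j"
proof
  assume "T X \<tau> \<omega> = enat j"
  then obtain b where b: "b + length \<tau> = j"
    "st (map (\<lambda>i. X i \<omega>) [b..<b + length \<tau>]) = \<tau>" by (rule T_eq_enatD)
  from assms(2) obtain a where a: "a + length \<sigma> = j"
    "st (map (\<lambda>i. X i \<omega>) [a..<a + length \<sigma>]) = \<sigma>" by (rule T_eq_enatD)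
  show False
  proof (cases "length \<sigma> \<le> length \<tau>")
    case True
    then show False
      using contains_pattern_if_common_end[OF True _ a(2) b(2)] a(1) b(1) assms(1)
      by (simp add: incomparable_def)
  next
    case False
    then have "length \<tau> \<le> length \<sigma>" by simp
    then show False
      using contains_pattern_if_common_end[OF _ _ b(2) a(2)] a(1) b(1) assms(1)
      by (simp add: incomparable_def)
  qed
qed

lemma measurable_T:
  assumes \<sigma>: "\<sigma> \<in> permutations_of_set {1..k}"
    and X [measurable]: "\<And>n. X n \<in> borel_measurable M"
  shows "T X \<sigma> \<in> measurable M (count_space UNIV)"
proof -
  let ?P = "\<lambda>j \<omega>. T X \<sigma> \<omega> \<le> enat j"
  have P: "?P j \<omega> \<longleftrightarrow> (\<exists>a. a + length \<sigma> \<le> j \<and>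
      (\<forall>p<length \<sigma>. \<forall>q<length \<sigma>. X (a + p) \<omega> \<le> X (a + q) \<omega> \<longleftrightarrow> \<sigma> ! p \<le> \<sigma> ! q))" for j \<omega>
    by (simp add: T_le_iff st_eq_permutation_iff[OF \<sigma>])
  have [measurable]: "Measurable.pred M (?P j)" for j
    unfolding P by measurable
  have "(\<lambda>\<omega>. if \<exists>j. ?P j \<omega> then enat (LEAST j. ?P j \<omega>) else \<infinity>)
      \<in> measurable M (count_space UNIV)"
    by measurable
  moreover have "T X \<sigma> = (\<lambda>\<omega>. if \<exists>j. ?P j \<omega> then enat (LEAST j. ?P j \<omega>) else \<infinity>)"
  proof
    fix \<omega>
    show "T X \<sigma> \<omega> = (if \<exists>j. ?P j \<omega> then enat (LEAST j. ?P j \<omega>) else \<infinity>)"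
    proof (cases "T X \<sigma> \<omega>")
      case (enat n)
      then have "(LEAST j. ?P j \<omega>) = n"
        by (intro Least_equality) auto
      with enat show ?thesis by auto
    qed auto
  qed
  ultimately show ?thesis by metis
qed

section \<open>Finite expectation of the first occurrence time\<close>

lemma (in real_distribution) continuous_cdf_attains:
  assumes cont: "continuous_on UNIV (cdf M)" and v: "0 < v" "v < 1"
  obtains c where "cdf M c = v"
proof -
  have "eventually (\<lambda>x. cdf M x < v) at_bot"
    using order_tendstoD(2)[OF cdf_lim_at_bot v(1)] .
  then obtain lo where lo: "cdf M lo < v"
    by (auto simp: eventually_at_bot_linorder)
  have "eventually (\<lambda>x. v < cdf M x) at_top"
    using order_tendstoD(1)[OF cdf_lim_at_top_prob v(2)] .
  then obtain hi where hi: "v < cdf M hi"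
    by (auto simp: eventually_at_top_linorder)
  have "lo \<le> hi"
    using cdf_nondecreasing[of hi lo] lo hi by linarith
  then obtain c where "cdf M c = v"
    using IVT'[of "cdf M" lo v hi] lo hi continuous_on_subset[OF cont, of "{lo..hi}"] by auto
  then show thesis by (rule that)
qed

text \<open>
  Quantiles of a continuous distribution cut the line into consecutive intervals of equal
  probability. When the \<open>a\<close>-th draw of a window falls into the interval numbered by the \<open>a\<close>-th
  entry of a permutation, for every \<open>a\<close>, the window is an occurrence of that permutation.
  Of the \<open>k + 2\<close> intervals of equal probability only \<open>k\<close> are kept: the two unbounded ones are dropped, which keeps all quantiles strictly between
  \<open>0\<close> and \<open>1\<close>, where the cumulative distribution function is certain to attain them.
\<close>

lemma (in real_distribution) equiprobable_ordered_sets: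
  assumes cont: "continuous_on UNIV (cdf M)"
  obtains I where "\<And>i. I i \<in> sets borel"
    and "\<And>i. i \<in> {1..k} \<Longrightarrow> measure M (I i) = 1 / (real k + 2)"
    and "\<And>i j x y. i \<in> {1..k} \<Longrightarrow> j \<in> {1..k} \<Longrightarrow> i < j \<Longrightarrow> x \<in> I i \<Longrightarrow> y \<in> I j \<Longrightarrow> x < y"
proof -
  have "\<exists>c. \<forall>i\<le>k. cdf M (c i) = (real i + 1) / (real k + 2)"
  proof (rule choice, rule allI)
    fix i
    show "\<exists>x. i \<le> k \<longrightarrow> cdf M x = (real i + 1) / (real k + 2)"
    proof (cases "i \<le> k")
      case True
      then obtain x where "cdf M x = (real i + 1) / (real k + 2)"
        using continuous_cdf_attains[OF cont, of "(real i + 1) / (real k + 2)"] by auto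
      then show ?thesis by blast
    qed simp
  qed
  then obtain c where c: "cdf M (c i) = (real i + 1) / (real k + 2)" if "i \<le> k" for i
    by blast
  have less: "c i < c j" if "i < j" "j \<le> k" for i j
  proof -
    have "cdf M (c i) < cdf M (c j)"
      using that by (simp add: c divide_strict_right_mono)
    then show ?thesis
      using cdf_nondecreasing[of "c j" "c i"] by force
  qed
  show thesis
  proof (rule that[of "\<lambda>i. {c (i - 1)<..c i}"])
    fix i assume i: "i \<in> {1..k}"
    then have "measure M {c (i - 1)<..c i} = cdf M (c i) - cdf M (c (i - 1))"
      by (intro cdf_diff_eq[symmetric] less) auto
    also have "\<dots> = (real i + 1) / (real k + 2) - (real (i - 1) + 1) / (real k + 2)"
      using i by (subst (1 2) c) auto
    also have "\<dots> = 1 / (real k + 2)"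
      using i by (simp add: of_nat_diff diff_divide_distrib[symmetric])
    finally show "measure M {c (i - 1)<..c i} = 1 / (real k + 2)" .
  next
    fix i j x y
    assume *: "i \<in> {1..k}" "j \<in> {1..k}" "i < j" "x \<in> {c (i - 1)<..c i}" "y \<in> {c (j - 1)<..c j}"
    have "c i \<le> c (j - 1)"
    proof (cases "i = j - 1")
      case False
      then show ?thesis using * by (intro less_imp_le less) auto
    qed simp
    with * show "x < y" by auto
  qed auto
qed

text \<open>
  The multiples of \<open>k\<close> below \<open>n\<close> are \<open>n / k\<close> in number, rounded up. The infinite series also covers
  \<open>n = \<infinity>\<close>.
\<close>

lemma ennreal_of_enat_le_tail_count:
  assumes "k > 0"
  shows "ennreal_of_enat n \<le> of_nat k * (\<Sum>m. if enat (m * k) < n then 1 else 0 :: ennreal)"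
proof -
  have *: "of_nat j \<le> of_nat k * (\<Sum>m. if enat (m * k) < n then 1 else 0 :: ennreal)"
    if j: "enat j \<le> n" for j
  proof -
    define N where "N = (j + k - 1) div k"
    have "k * N + (j + k - 1) mod k = j + k - 1"
      unfolding N_def by (rule mult_div_mod_eq)
    moreover have "(j + k - 1) mod k < k"
      using assms by (rule mod_less_divisor)
    ultimately have "j \<le> k * N" by linarith
    then have "(of_nat j :: ennreal) \<le> of_nat (k * N)"
      by (simp only: of_nat_le_iff)
    also have "\<dots> = of_nat k * (\<Sum>m<N. 1)"
      by simp
    also have "(\<Sum>m<N. 1 :: ennreal) = (\<Sum>m<N. if enat (m * k) < n then 1 else 0)"
    proof (rule sum.cong)
      fix m assume "m \<in> {..<N}"
      then have "Suc m \<le> (j + k - 1) div k" by (simp add: N_def)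
      then have "Suc m * k \<le> j + k - 1"
        using less_eq_div_iff_mult_less_eq[OF assms] by blast
      then have "m * k < j" using assms by simp
      with j show "1 = (if enat (m * k) < n then 1 else 0 :: ennreal)"
        by (metis enat_ord_simps(2) order_less_le_trans)
    qed simp
    also have "of_nat k * \<dots> \<le> of_nat k * (\<Sum>m. if enat (m * k) < n then 1 else 0 :: ennreal)"
      by (intro mult_left_mono sum_le_suminf) auto
    finally show ?thesis .
  qed
  show ?thesis
  proof (cases n)
    case (enat j)
    then show ?thesis using *[of j] by simp
  next
    case infinity
    \<comment> \<open>The right-hand side dominates every natural number, so it is infinite.\<close>
    have "of_nat k * (\<Sum>m. if enat (m * k) < n then 1 else 0 :: ennreal) = top"
      using * infinity by (metis ennreal_Ex_less_of_nat enat_ord_code(3) leD top.not_eq_extremum)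
    then show ?thesis by simp
  qed
qed

text \<open>
  The first \<open>m k\<close> draws split into \<open>m\<close> disjoint blocks of \<open>k\<close>. In each block, independently of the
  others, the draws fall into the intervals prescribed by \<open>\<sigma>\<close> with the same positive probability.
  If \<open>\<sigma>\<close> has not appeared, all \<open>m\<close> blocks have missed, which has probability \<open>r ^ m\<close>.
\<close>

lemma (in prob_space) T_tail_le:
  assumes indep: "indep_vars (\<lambda>_. borel) X UNIV"
    and ident: "\<And>n. distr M borel (X n) = distr M borel (X 0)"
    and cont: "continuous_on UNIV (cdf (distr M borel (X 0)))"
    and \<sigma>: "\<sigma> \<in> permutations_of_set {1..k}" and "k > 0"
  obtains r where "0 \<le> r" "r < 1"
    and "\<And>m. prob {\<omega> \<in> space M. enat (m * k) < T X \<sigma> \<omega>} \<le> r ^ m"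
proof -
  have X [measurable]: "X n \<in> borel_measurable M" for n
    using indep by (simp add: indep_vars_def)
  have len: "length \<sigma> = k" and dist: "distinct \<sigma>" and set: "set \<sigma> = {1..k}"
    using \<sigma> distinct_card[of \<sigma>] by (auto simp: permutations_of_set_def)
  interpret D: real_distribution "distr M borel (X 0)"
    by (rule real_distribution_distr) simp
  define p where "p = 1 / (real k + 2)"
  obtain I where I: "I i \<in> sets borel"
      "i \<in> {1..k} \<Longrightarrow> measure (distr M borel (X 0)) (I i) = p"
      "i \<in> {1..k} \<Longrightarrow> j \<in> {1..k} \<Longrightarrow> i < j \<Longrightarrow> x \<in> I i \<Longrightarrow> y \<in> I j \<Longrightarrow> x < y" for i j x y
    unfolding p_def using D.equiprobable_ordered_sets[OF cont, of k] by metis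
  have p: "0 < p" "p < 1" by (auto simp: p_def)
  define K where "K m = {m * k..<m * k + k}" for m
  define A where "A m n = I (\<sigma> ! (n - m * k))" for m n
  \<comment> \<open>Block \<open>m\<close> has its draws in the prescribed intervals.\<close>
  define E where "E m = {\<omega> \<in> space M. \<forall>n\<in>K m. X n \<omega> \<in> A m n}" for m
  have A [measurable]: "A m n \<in> sets borel" for m n
    by (simp add: A_def I(1))
  have prob_A: "prob (X n -` A m n \<inter> space M) = p" if "n \<in> K m" for m n
  proof -
    have "\<sigma> ! (n - m * k) \<in> {1..k}"
      using that nth_mem[of "n - m * k" \<sigma>] by (auto simp: K_def len set)
    moreover have "prob (X n -` A m n \<inter> space M) = measure (distr M borel (X n)) (A m n)"
      by (simp add: measure_distr)
    ultimately show ?thesis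
      by (simp add: ident[of n] A_def I(2))
  qed
  have K: "K m \<noteq> {}" "finite (K m)" "card (K m) = k" for m
    using \<open>k > 0\<close> by (auto simp: K_def)
  have prob_E: "prob (E m) = p ^ k" for m
  proof -
    have "E m = (\<Inter>n\<in>K m. X n -` A m n \<inter> space M)"
      using K(1)[of m] by (auto simp: E_def)
    then have "prob (E m) = (\<Prod>n\<in>K m. prob (X n -` A m n \<inter> space M))"
      using indep_varsD[OF indep K(1,2)[of m], of "A m"] by simp
    then show ?thesis by (simp add: prob_A K(3))
  qed
  have events_E: "E m \<in> events" for m
  proof -
    have "E m = {\<omega> \<in> space M. \<forall>n\<in>K m. X n \<omega> \<in> A m n}" by (simp add: E_def)
    also have "\<dots> \<in> events" using K(2)[of m] by measurable
    finally show ?thesis .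
  qed
  \<comment> \<open>The blocks are independent as vectors; \<open>C\<close> is the set of vectors for which a block misses.\<close>
  define Z where "Z m \<omega> = restrict (\<lambda>n. X n \<omega>) (K m)" for m \<omega>
  define C where "C m = space (PiM (K m) (\<lambda>_. borel)) - PiE (K m) (A m)" for m
  have disj: "disjoint_family_on K UNIV"
    unfolding disjoint_family_on_def
  proof (intro ballI impI)
    fix m n :: nat assume "m \<noteq> n"
    then have "Suc m * k \<le> n * k \<or> Suc n * k \<le> m * k"
      by (metis Suc_leI linorder_neqE_nat mult_le_mono1)
    then show "K m \<inter> K n = {}" by (auto simp: K_def)
  qed
  have indep_Z: "indep_vars (\<lambda>m. PiM (K m) (\<lambda>_. borel)) Z UNIV"
    unfolding Z_def using indep_vars_restrict[OF indep _ disj] by simp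
  have C: "C m \<in> sets (PiM (K m) (\<lambda>_. borel))" for m
    unfolding C_def using K(2)[of m] by (intro sets.compl_sets sets_PiM_I_finite) auto
  have Z_C: "Z m -` C m \<inter> space M = space M - E m" for m
    by (auto simp: Z_def C_def E_def space_PiM PiE_iff)
  have hit: "T X \<sigma> \<omega> \<le> enat (m * k)" if "\<omega> \<in> E j" "j < m" for \<omega> j m
  proof -
    have "Suc j * k \<le> m * k" using that(2) by (intro mult_le_mono1) simp
    moreover have "st (map (\<lambda>i. X i \<omega>) [j * k..<j * k + length \<sigma>]) = \<sigma>"
      unfolding st_eq_permutation_iff[OF \<sigma>]
    proof (intro conjI allI impI)
      fix a b assume ab: "a < length \<sigma>" "b < length \<sigma>"
      have in_I: "X (j * k + c) \<omega> \<in> I (\<sigma> ! c)" and rng: "\<sigma> ! c \<in> {1..k}" if "c < length \<sigma>" for c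
      proof -
        have "X (j * k + c) \<omega> \<in> A j (j * k + c)"
          using \<open>\<omega> \<in> E j\<close> that by (simp add: E_def K_def len)
        then show "X (j * k + c) \<omega> \<in> I (\<sigma> ! c)" by (simp add: A_def)
        show "\<sigma> ! c \<in> {1..k}" using nth_mem[OF that] by (simp add: set)
      qed
      consider "a = b" | "\<sigma> ! a < \<sigma> ! b" | "\<sigma> ! b < \<sigma> ! a"
        using ab dist nth_eq_iff_index_eq linorder_neqE_nat by metis
      then have "X (j * k + a) \<omega> \<le> X (j * k + b) \<omega> \<longleftrightarrow> \<sigma> ! a \<le> \<sigma> ! b"
      proof cases
        case 2
        then show ?thesis using I(3)[OF rng rng 2 in_I in_I] ab by simp
      next
        case 3
        then show ?thesis using I(3)[OF rng rng 3 in_I in_I] ab by simp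
      qed simp
      then show "map (\<lambda>i. X i \<omega>) [j * k..<j * k + length \<sigma>] ! a
          \<le> map (\<lambda>i. X i \<omega>) [j * k..<j * k + length \<sigma>] ! b \<longleftrightarrow> \<sigma> ! a \<le> \<sigma> ! b"
        using ab by simp
    qed simp
    ultimately show ?thesis
      unfolding T_le_iff by (intro exI[of _ "j * k"]) (simp add: len)
  qed
  show thesis
  proof (rule that[of "1 - p ^ k"])
    show "0 \<le> 1 - p ^ k" using p by (simp add: power_le_one)
    show "1 - p ^ k < 1" using p by simp
    show "prob {\<omega> \<in> space M. enat (m * k) < T X \<sigma> \<omega>} \<le> (1 - p ^ k) ^ m" for m
    proof (cases "m = 0")
      case False
      then have "prob (\<Inter>j\<in>{..<m}. Z j -` C j \<inter> space M)
          = (\<Prod>j\<in>{..<m}. prob (Z j -` C j \<inter> space M))"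
        using C by (intro indep_varsD[OF indep_Z]) auto
      also have "\<dots> = (1 - p ^ k) ^ m"
        by (simp add: Z_C prob_compl events_E prob_E)
      finally have eq: "prob (\<Inter>j\<in>{..<m}. space M - E j) = (1 - p ^ k) ^ m"
        by (simp add: Z_C)
      have "{\<omega> \<in> space M. enat (m * k) < T X \<sigma> \<omega>} \<subseteq> (\<Inter>j\<in>{..<m}. space M - E j)"
        using hit by (auto simp flip: not_le)
      then have "prob {\<omega> \<in> space M. enat (m * k) < T X \<sigma> \<omega>} \<le> prob (\<Inter>j\<in>{..<m}. space M - E j)"
        using False events_E by (intro finite_measure_mono sets.finite_INT) auto
      with eq show ?thesis by simp
    qed simp
  qed
qed

lemma (in prob_space) nn_integral_T_finite:
  assumes indep: "indep_vars (\<lambda>_. borel) X UNIV"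
    and ident: "\<And>n. distr M borel (X n) = distr M borel (X 0)"
    and cont: "continuous_on UNIV (cdf (distr M borel (X 0)))"
    and \<sigma>: "\<sigma> \<in> permutations_of_set {1..k}" and k: "k > 0"
  shows "(\<integral>\<^sup>+\<omega>. ennreal_of_enat (T X \<sigma> \<omega>) \<partial>M) < \<infinity>"
proof -
  have "X n \<in> borel_measurable M" for n
    using indep by (simp add: indep_vars_def)
  from measurable_T[OF \<sigma> this] have [measurable]: "T X \<sigma> \<in> measurable M (count_space UNIV)" .
  obtain r where r: "0 \<le> r" "r < 1"
    and tail: "\<And>m. prob {\<omega> \<in> space M. enat (m * k) < T X \<sigma> \<omega>} \<le> r ^ m"
    using T_tail_le[OF assms] by blast
  have "(\<integral>\<^sup>+\<omega>. ennreal_of_enat (T X \<sigma> \<omega>) \<partial>M)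
      \<le> (\<integral>\<^sup>+\<omega>. of_nat k * (\<Sum>m. if enat (m * k) < T X \<sigma> \<omega> then 1 else 0) \<partial>M)"
    by (intro nn_integral_mono ennreal_of_enat_le_tail_count k)
  also have "\<dots> = of_nat k * (\<Sum>m. \<integral>\<^sup>+\<omega>. (if enat (m * k) < T X \<sigma> \<omega> then 1 else 0) \<partial>M)"
    by (simp add: nn_integral_cmult nn_integral_suminf)
  also have "\<dots> \<le> of_nat k * (\<Sum>m. ennreal (r ^ m))"
  proof (intro mult_left_mono suminf_le)
    fix m
    have "(\<integral>\<^sup>+\<omega>. (if enat (m * k) < T X \<sigma> \<omega> then 1 else 0) \<partial>M)
        = (\<integral>\<^sup>+\<omega>. indicator {\<omega> \<in> space M. enat (m * k) < T X \<sigma> \<omega>} \<omega> \<partial>M)"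
      by (intro nn_integral_cong) auto
    also have "\<dots> = emeasure M {\<omega> \<in> space M. enat (m * k) < T X \<sigma> \<omega>}"
      by (intro nn_integral_indicator) measurable
    also have "\<dots> \<le> ennreal (r ^ m)"
      unfolding emeasure_eq_measure by (intro ennreal_leI tail)
    finally show "(\<integral>\<^sup>+\<omega>. (if enat (m * k) < T X \<sigma> \<omega> then 1 else 0) \<partial>M) \<le> ennreal (r ^ m)" .
  qed auto
  also have "(\<Sum>m. ennreal (r ^ m)) = ennreal (1 / (1 - r))"
    using r by (intro suminf_ennreal_eq geometric_sums) auto
  also have "of_nat k * \<dots> < \<infinity>"
    by (simp add: less_top[symmetric] ennreal_mult_eq_top_iff)
  finally show ?thesis .
qed

section \<open>The race between two patterns\<close>

lemma AE_finite_if_nn_integral_finite: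
  assumes [measurable]: "f \<in> measurable M (count_space UNIV)"
    and "(\<integral>\<^sup>+\<omega>. ennreal_of_enat (f \<omega>) \<partial>M) < \<infinity>"
  shows "AE \<omega> in M. f \<omega> \<noteq> \<infinity>"
proof -
  have "AE \<omega> in M. ennreal_of_enat (f \<omega>) \<noteq> \<infinity>"
    using assms(2) by (intro nn_integral_PInf_AE) auto
  then show ?thesis by eventually_elim (metis ennreal_of_enat_infty)
qed

lemma sets_less_enat:
  fixes f g :: "'w \<Rightarrow> enat"
  assumes "f \<in> measurable M (count_space UNIV)" "g \<in> measurable M (count_space UNIV)"
  shows "{\<omega> \<in> space M. f \<omega> < g \<omega>} \<in> sets M"
proof -
  have "f \<in> borel_measurable M" "g \<in> borel_measurable M"
    using assms[THEN measurable_compose, of "\<lambda>x. x" borel] by simp_all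
  then show ?thesis by measurable
qed

text \<open>
  Multiplying a conditional expectation by the probability of the condition gives an expectation over
  the whole space. The truncated difference \<open>T X \<tau> \<omega> - T X \<sigma> \<omega>\<close> already vanishes when \<open>\<tau>\<close> comes first,
  so no indicator is left on the right. If \<open>\<sigma>\<close> almost surely never comes first, conditioning yields
  the zero measure, \<open>f = 0\<close>, and the identity survives. The lower bound on \<open>f\<close> comes from the
  difference of distinct integers being at least 1.
\<close>

lemma (in prob_space) mean_F_weighted:
  assumes [measurable]: "T X \<sigma> \<in> measurable M (count_space UNIV)"
      "T X \<tau> \<in> measurable M (count_space UNIV)"
    and finite: "(\<integral>\<^sup>+\<omega>. ennreal_of_enat (T X \<tau> \<omega>) \<partial>M) < \<infinity>"
  obtains f where "mean_F M X \<sigma> \<tau> = ereal f" and "0 \<le> f"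
    and "(\<integral>\<^sup>+\<omega>. ennreal_of_enat (T X \<tau> \<omega> - T X \<sigma> \<omega>) \<partial>M)
      = ennreal (prob {\<omega> \<in> space M. T X \<sigma> \<omega> < T X \<tau> \<omega>} * f)"
    and "prob {\<omega> \<in> space M. T X \<sigma> \<omega> < T X \<tau> \<omega>} > 0 \<Longrightarrow> 1 \<le> f"
proof -
  define A where "A = {\<omega> \<in> space M. T X \<sigma> \<omega> < T X \<tau> \<omega>}"
  have A [measurable]: "A \<in> events" unfolding A_def by (rule sets_less_enat) measurable
  let ?d = "\<lambda>\<omega>. ennreal_of_enat (T X \<tau> \<omega> - T X \<sigma> \<omega>)"
  have AE_fin: "AE \<omega> in M. T X \<tau> \<omega> \<noteq> \<infinity>"
    using assms(2) finite by (rule AE_finite_if_nn_integral_finite)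
  \<comment> \<open>On \<open>enat\<close> the difference \<open>\<infinity> - \<infinity>\<close> is \<open>\<infinity>\<close>, hence the appeal to almost sure finiteness.\<close>
  have ind: "(\<integral>\<^sup>+\<omega>. ?d \<omega> * indicator A \<omega> \<partial>M) = (\<integral>\<^sup>+\<omega>. ?d \<omega> \<partial>M)"
  proof (rule nn_integral_cong_AE, use AE_fin AE_space in eventually_elim)
    case (elim \<omega>)
    then show ?case
      by (cases "T X \<tau> \<omega>"; cases "T X \<sigma> \<omega>") (auto simp: A_def indicator_def)
  qed
  have le: "(\<integral>\<^sup>+\<omega>. ?d \<omega> \<partial>M) \<le> (\<integral>\<^sup>+\<omega>. ennreal_of_enat (T X \<tau> \<omega>) \<partial>M)"
  proof (intro nn_integral_mono)
    fix \<omega>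
    show "?d \<omega> \<le> ennreal_of_enat (T X \<tau> \<omega>)"
      by (cases "T X \<tau> \<omega>"; cases "T X \<sigma> \<omega>") (auto simp flip: enat_0)
  qed
  then obtain u where u: "0 \<le> u" "(\<integral>\<^sup>+\<omega>. ?d \<omega> \<partial>M) = ennreal u"
    using finite by (cases "\<integral>\<^sup>+\<omega>. ?d \<omega> \<partial>M") (auto simp: top_unique)
  have ge: "prob A \<le> u"
  proof -
    have "ennreal (prob A) = (\<integral>\<^sup>+\<omega>. indicator A \<omega> \<partial>M)"
      by (simp add: emeasure_eq_measure)
    also have "\<dots> \<le> (\<integral>\<^sup>+\<omega>. ?d \<omega> \<partial>M)"
    proof (intro nn_integral_mono)
      fix \<omega>
      show "indicator A \<omega> \<le> ?d \<omega>"
        by (cases "T X \<tau> \<omega>"; cases "T X \<sigma> \<omega>") (auto simp: A_def indicator_def simp flip: of_nat_diff)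
    qed
    finally show ?thesis using u by simp
  qed
  have null: "u = 0" if "prob A = 0"
  proof -
    have "emeasure M A = 0" using that by (simp add: emeasure_eq_measure)
    then have "(\<integral>\<^sup>+\<omega>. ?d \<omega> * indicator A \<omega> \<partial>M) = 0"
      using nn_integral_null_set[of A M ?d] A by (auto simp: null_sets_def)
    then show ?thesis using ind u by simp
  qed
  have "mean_F M X \<sigma> \<tau> = enn2ereal (\<integral>\<^sup>+\<omega>. ?d \<omega> \<partial>uniform_measure M A)"
    unfolding mean_F_def mean_def F_law_def A_def[symmetric]
    by (subst nn_integral_distr) auto
  also have "(\<integral>\<^sup>+\<omega>. ?d \<omega> \<partial>uniform_measure M A) = ennreal u / ennreal (prob A)"
    by (subst nn_integral_uniform_measure) (simp_all add: ind u emeasure_eq_measure)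
  also have "\<dots> = ennreal (u / prob A)"
    using null u(1) by (cases "prob A = 0") (simp_all add: divide_ennreal zero_less_measure_iff)
  finally have "mean_F M X \<sigma> \<tau> = ereal (u / prob A)"
    using u(1) by simp
  moreover have "ennreal u = ennreal (prob A * (u / prob A))"
    using null by (cases "prob A = 0") simp_all
  ultimately show thesis
    using that[of "u / prob A"] u ge unfolding A_def[symmetric] by simp
qed

text \<open>Both sides are the maximum of \<open>m\<close> and \<open>n\<close>.\<close>

lemma enat_add_diff_eq_add_diff: "m + (n - m) = n + (m - n)" for m n :: enat
  by (cases m; cases n) auto

lemma share_eq_if_balanced:
  fixes p q a b f g :: real
  assumes "a + p * f = b + q * g" and "p + q = 1" and "0 < g + f"
  shows "p = (g + b - a) / (g + f)"
proof -
  have q: "q = 1 - p" using assms(2) by simp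
  have "p * (g + f) = g + b - a"
    using assms(1) unfolding q by (simp add: algebra_simps)
  with assms(3) show ?thesis by (simp add: eq_divide_eq)
qed

lemma nonempty_if_not_contained:
  assumes "\<not> contains_pattern xs \<sigma>"
  shows "\<sigma> \<noteq> []"
proof
  assume "\<sigma> = []"
  then have "contains_pattern xs \<sigma>"
    unfolding contains_pattern_def by (intro exI[of _ "[]"]) (simp add: st_def)
  with assms show False by contradiction
qed

theorem theorem3p5:
  fixes M :: "'w measure" and X :: "nat \<Rightarrow> 'w \<Rightarrow> real"
    and \<sigma> \<tau> :: "nat list" and k l :: nat
  assumes "prob_space M"
    and "prob_space.indep_vars M (\<lambda>_. borel) X UNIV"
    and "\<And>n. distr M borel (X n) = distr M borel (X 0)"
    and "continuous_on UNIV (cdf (distr M borel (X 0)))"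
    and "\<sigma> \<in> permutations_of_set {1..k}"
    and "\<tau> \<in> permutations_of_set {1..l}"
    and "incomparable \<sigma> \<tau>"
  shows "ereal (measure M {\<omega> \<in> space M. T X \<sigma> \<omega> < T X \<tau> \<omega>}) =
    (mean_F M X \<tau> \<sigma> + mean_T M X \<tau> - mean_T M X \<sigma>) / (mean_F M X \<tau> \<sigma> + mean_F M X \<sigma> \<tau>)"
proof -
  interpret prob_space M by fact
  have X: "X n \<in> borel_measurable M" for n
    using assms(2) by (simp add: indep_vars_def)
  note meas = measurable_T[OF assms(5) X] measurable_T[OF assms(6) X]
  have "\<sigma> \<noteq> []" "\<tau> \<noteq> []"
    using assms(7) nonempty_if_not_contained by (auto simp: incomparable_def)
  then have "k > 0" "l > 0"
    using assms(5,6) by (auto simp: permutations_of_set_def intro!: Nat.gr0I)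
  note fin = nn_integral_T_finite[OF assms(2,3,4,5) \<open>k > 0\<close>]
    nn_integral_T_finite[OF assms(2,3,4,6) \<open>l > 0\<close>]
  obtain a where a: "0 \<le> a" "(\<integral>\<^sup>+\<omega>. ennreal_of_enat (T X \<sigma> \<omega>) \<partial>M) = ennreal a"
    using fin(1) by (cases "\<integral>\<^sup>+\<omega>. ennreal_of_enat (T X \<sigma> \<omega>) \<partial>M") auto
  obtain b where b: "0 \<le> b" "(\<integral>\<^sup>+\<omega>. ennreal_of_enat (T X \<tau> \<omega>) \<partial>M) = ennreal b"
    using fin(2) by (cases "\<integral>\<^sup>+\<omega>. ennreal_of_enat (T X \<tau> \<omega>) \<partial>M") auto
  let ?p = "prob {\<omega> \<in> space M. T X \<sigma> \<omega> < T X \<tau> \<omega>}"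
  let ?q = "prob {\<omega> \<in> space M. T X \<tau> \<omega> < T X \<sigma> \<omega>}"
  obtain f where f: "mean_F M X \<sigma> \<tau> = ereal f" "0 \<le> f"
    "(\<integral>\<^sup>+\<omega>. ennreal_of_enat (T X \<tau> \<omega> - T X \<sigma> \<omega>) \<partial>M) = ennreal (?p * f)" "?p > 0 \<Longrightarrow> 1 \<le> f"
    using mean_F_weighted[OF meas fin(2)] by blast
  obtain g where g: "mean_F M X \<tau> \<sigma> = ereal g" "0 \<le> g"
    "(\<integral>\<^sup>+\<omega>. ennreal_of_enat (T X \<sigma> \<omega> - T X \<tau> \<omega>) \<partial>M) = ennreal (?q * g)" "?q > 0 \<Longrightarrow> 1 \<le> g"
    using mean_F_weighted[OF meas(2,1) fin(1)] by blast
  note [measurable] = meas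
  \<comment> \<open>Both sides are the expectation of the later of the two times.\<close>
  have balance: "a + ?p * f = b + ?q * g"
  proof -
    have "ennreal a + ennreal (?p * f)
        = (\<integral>\<^sup>+\<omega>. ennreal_of_enat (T X \<sigma> \<omega> + (T X \<tau> \<omega> - T X \<sigma> \<omega>)) \<partial>M)"
      unfolding a(2)[symmetric] f(3)[symmetric] ennreal_of_enat_plus
      by (rule nn_integral_add[symmetric]) measurable
    also have "\<dots> = (\<integral>\<^sup>+\<omega>. ennreal_of_enat (T X \<tau> \<omega> + (T X \<sigma> \<omega> - T X \<tau> \<omega>)) \<partial>M)"
      by (subst enat_add_diff_eq_add_diff) (rule refl)
    also have "\<dots> = ennreal b + ennreal (?q * g)"
      unfolding b(2)[symmetric] g(3)[symmetric] ennreal_of_enat_plus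
      by (rule nn_integral_add) measurable
    finally show ?thesis
      using a(1) b(1) f(2) g(2) by (simp flip: ennreal_plus)
  qed
  have total: "?p + ?q = 1"
  proof -
    have "AE \<omega> in M. T X \<sigma> \<omega> \<noteq> \<infinity>"
      using meas(1) fin(1) by (rule AE_finite_if_nn_integral_finite)
    then have "AE \<omega> in M. T X \<sigma> \<omega> < T X \<tau> \<omega> \<or> T X \<tau> \<omega> < T X \<sigma> \<omega>"
    proof eventually_elim
      case (elim \<omega>)
      then show ?case
        using T_neq_if_incomparable[OF assms(7)] by (metis not_enat_eq linorder_neqE)
    qed
    then have "AE \<omega> in M. \<omega> \<in> {\<omega> \<in> space M. T X \<sigma> \<omega> < T X \<tau> \<omega>}
        \<union> {\<omega> \<in> space M. T X \<tau> \<omega> < T X \<sigma> \<omega>}"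
      using AE_space by eventually_elim blast
    then have "prob ({\<omega> \<in> space M. T X \<sigma> \<omega> < T X \<tau> \<omega>}
        \<union> {\<omega> \<in> space M. T X \<tau> \<omega> < T X \<sigma> \<omega>}) = 1"
      by (intro prob_eq_1[THEN iffD2] sets.Un sets_less_enat meas)
    moreover have "{\<omega> \<in> space M. T X \<sigma> \<omega> < T X \<tau> \<omega>}
        \<inter> {\<omega> \<in> space M. T X \<tau> \<omega> < T X \<sigma> \<omega>} = {}"
      by (auto dest: less_asym)
    then have "prob ({\<omega> \<in> space M. T X \<sigma> \<omega> < T X \<tau> \<omega>}
        \<union> {\<omega> \<in> space M. T X \<tau> \<omega> < T X \<sigma> \<omega>}) = ?p + ?q"
      by (rule finite_measure_Union[OF sets_less_enat[OF meas] sets_less_enat[OF meas(2,1)]])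
    ultimately show ?thesis by linarith
  qed
  \<comment> \<open>At least one of the two orders has positive probability, and its waiting time is at least 1.\<close>
  have "0 < g + f"
  proof (cases "?p > 0")
    case True
    then show ?thesis using f(4) g(2) by linarith
  next
    case False
    then have "?q > 0" using total by linarith
    then show ?thesis using f(2) g(4) by linarith
  qed
  then have "?p = (g + b - a) / (g + f)"
    by (rule share_eq_if_balanced[OF balance total])
  moreover have "mean_T M X \<sigma> = ereal a" "mean_T M X \<tau> = ereal b"
    using a b by (simp_all add: mean_T_def mean_def)
  ultimately show ?thesis
    using f(1) g(1) \<open>0 < g + f\<close> by simp
qed

end
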